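(* Let $\mathbb{F}_q$ be the finite field with $q$ elements and let $n>1$, $l>0$ and $m>0$ be integers. Let $f,g\in\mathbb{F}_q[x_1,x_2,\ldots,x_n]$ be random polynomials of the form $$f=c\,x_1^l+\sum_{i=0}^{l-1}c_{l-i}(x_2,\ldots,x_n)\,x_1^i,\qquad g=d\,x_1^m+\sum_{i=0}^{m-1}d_{m-i}(x_2,\ldots,x_n)\,x_1^i,$$ where $c,d\in\mathbb{F}_q$ are nonzero constants, $c_{l-i},d_{m-i}\in\mathbb{F}_q[x_2,\ldots,x_n]$ have total degrees $\deg c_{l-i}\le l-i$ and $\deg d_{m-i}\le m-i$ (thus $f$ and $g$ have total degree $l$ and $m$ respectively), and the pair $(f,g)$ is chosen uniformly at random among all pairs of polynomials of this form. Let $X$ be the random variable which counts the number of $\gamma=(\gamma_2,\ldots,\gamma_n)\in\mathbb{F}_q^{n-1}$ such that $\gcd(f(x_1,\gamma_2,\ldots,\gamma_n),g(x_1,\gamma_2,\ldots,\gamma_n))\neq 1$ in $\mathbb{F}_q[x_1]$. Then: (a) $\mathrm{E}[X]=q^{n-2}$; and (b) $\mathrm{Var}[X]=q^{n-2}(1-1/q)$.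
   Context: $\mathrm{E}[X]$ and $\mathrm{Var}[X]$ denote the expected value and variance of a random variable $X$. The gcd of two univariate polynomials over $\mathbb{F}_q$ is taken to be monic, so $\gcd\neq 1$ means the two polynomials are not coprime. The zero polynomial is regarded as satisfying every degree bound, so the coefficients $c_{l-i}$, $d_{m-i}$ may be zero. *)

theory Defs
  imports
    "HOL-Probability.Probability"
    "HOL-Computational_Algebra.Polynomial"
    "HOL-Library.Poly_Mapping"
begin

text \<open>
  A finitely supported map on exponent vectors is a polynomial in the indeterminates
  \<open>x\<^sub>0, x\<^sub>1, x\<^sub>2, \<dots>\<close>; polynomials in fewer indeterminates are singled out by \<open>mp_vars\<close>.
  The ring structure is the convolution product of \<^theory>\<open>HOL-Library.Poly_Mapping\<close>.
\<close>

type_synonym 'a mp = "(nat \<Rightarrow>\<^sub>0 nat) \<Rightarrow>\<^sub>0 'a"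

definition mp_const :: "'a::zero \<Rightarrow> 'a mp" where
  "mp_const c = Poly_Mapping.single 0 c"

definition mp_x :: "nat \<Rightarrow> 'a::zero_neq_one mp" where
  "mp_x i = Poly_Mapping.single (Poly_Mapping.single i 1) 1"

definition mp_vars :: "'a::zero mp \<Rightarrow> nat set" where
  "mp_vars p = (\<Union>t\<in>Poly_Mapping.keys p. Poly_Mapping.keys t)"

text \<open>The zero polynomial satisfies every degree bound.\<close>

definition total_degree_le :: "'a::zero mp \<Rightarrow> nat \<Rightarrow> bool" where
  "total_degree_le p d \<longleftrightarrow>
     (\<forall>t\<in>Poly_Mapping.keys p. (\<Sum>i\<in>Poly_Mapping.keys t. Poly_Mapping.lookup t i) \<le> d)"

definition mp_eval :: "('a::zero \<Rightarrow> 'b::comm_semiring_1) \<Rightarrow> (nat \<Rightarrow> 'b) \<Rightarrow> 'a mp \<Rightarrow> 'b" where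
  "mp_eval h s p =
     (\<Sum>t\<in>Poly_Mapping.keys p. h (Poly_Mapping.lookup p t) *
        (\<Prod>i\<in>Poly_Mapping.keys t. s i ^ Poly_Mapping.lookup t i))"

text \<open>\<open>f(x\<^sub>1, \<gamma>\<^sub>2, \<dots>, \<gamma>\<^sub>n)\<close> as a univariate polynomial in \<open>x\<^sub>1\<close>.\<close>

definition specialize :: "(nat \<Rightarrow> 'a::comm_semiring_1) \<Rightarrow> 'a mp \<Rightarrow> 'a poly" where
  "specialize \<gamma> = mp_eval (\<lambda>a. [:a:]) (\<lambda>i. if i = 1 then [:0, 1:] else [:\<gamma> i:])"

definition form_polys :: "nat \<Rightarrow> nat \<Rightarrow> 'a::field mp set" where
  "form_polys n l =
     {mp_const c * mp_x 1 ^ l + (\<Sum>i<l. C (l - i) * mp_x 1 ^ i) | c C.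
        c \<noteq> 0 \<and> (\<forall>i<l. mp_vars (C (l - i)) \<subseteq> {2..n} \<and> total_degree_le (C (l - i)) (l - i))}"

definition noncoprime_count :: "nat \<Rightarrow> 'a::field mp \<Rightarrow> 'a mp \<Rightarrow> nat" where
  "noncoprime_count n f g =
     card {\<gamma> \<in> {2..n} \<rightarrow>\<^sub>E UNIV. \<not> coprime (specialize \<gamma> f) (specialize \<gamma> g)}"

definition random_pair :: "nat \<Rightarrow> nat \<Rightarrow> nat \<Rightarrow> ('a::{finite,field} mp \<times> 'a mp) pmf" where
  "random_pair n l m = pmf_of_set (form_polys n l \<times> form_polys n m)"

text \<open>
  The library's \<open>gcd\<close> on polynomials needs more type-class structure on the coefficients
  than \<open>field\<close>, so \<open>noncoprime_count\<close> uses \<open>coprime\<close>. It agrees with \<open>gcd \<noteq> 1\<close> for the monic gcd: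
\<close>

lemma monic_gcd_neq_1_iff_not_coprime:
  fixes p q d :: "'a::field poly"
  assumes "lead_coeff d = 1" "d dvd p" "d dvd q"
    and "\<And>e. e dvd p \<Longrightarrow> e dvd q \<Longrightarrow> e dvd d"
  shows "d \<noteq> 1 \<longleftrightarrow> \<not> coprime p q"
proof
  assume "d \<noteq> 1"
  show "\<not> coprime p q"
  proof
    assume "coprime p q"
    then have "is_unit d" using assms(2,3) by (rule coprime_common_divisor)
    then obtain c where "d = [:c:]" by (auto simp: is_unit_poly_iff)
    with assms(1) \<open>d \<noteq> 1\<close> show False by (simp add: one_pCons)
  qed
next
  assume "\<not> coprime p q"
  then show "d \<noteq> 1" using assms(4) by (auto simp: coprime_def)
qed

end

theory Submission imports Defs begin

text \<open>
  Among the \<open>q\<^bsup>l+m\<^esup>\<close> pairs of monic univariate polynomials of degrees \<open>l, m > 0\<close>, exactly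
  one in \<open>q\<close> is not coprime: splitting off the monic gcd of degree \<open>k\<close> expresses
  \<open>q\<^bsup>l+m\<^esup>\<close> as the sum of \<open>q\<^sup>k\<close> times the number of coprime pairs of degrees \<open>l - k, m - k\<close>.
  For a random \<open>f\<close> and points \<open>\<gamma> \<noteq> \<delta>\<close>, the monic parts of \<open>f(x\<^sub>1, \<gamma>)\<close> and
  \<open>f(x\<^sub>1, \<delta>)\<close> are independent and uniform. Since coprimality only depends on the monic
  parts, \<open>X\<close> is a sum of \<open>q\<^bsup>n-1\<^esup>\<close> pairwise independent indicators of probability \<open>1/q\<close>.
\<close>

section \<open>Counting\<close>

text \<open>Partitioning \<open>A\<close> by the value of \<open>\<Psi>\<close> moves the count of
  any event in \<open>\<Psi> x\<close> from \<open>A\<close> to \<open>B\<close>, up to the common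
  fibre size.\<close>

lemma card_filter_uniform_fibres:
  assumes "finite A" "finite B" "\<Psi> ` A \<subseteq> B"
    and fibre: "\<And>b. b \<in> B \<Longrightarrow> card {x \<in> A. \<Psi> x = b} = K"
  shows "card {x \<in> A. R (\<Psi> x)} = K * card {b \<in> B. R b}"
proof -
  have "{x \<in> A. R (\<Psi> x)} = (\<Union>b\<in>{b \<in> B. R b}. {x \<in> A. \<Psi> x = b})"
    using assms(3) by auto
  also have "card \<dots> = (\<Sum>b\<in>{b \<in> B. R b}. card {x \<in> A. \<Psi> x = b})"
    using assms(1,2) by (intro card_UN_disjoint) auto
  also have "\<dots> = K * card {b \<in> B. R b}"
    using fibre by simp
  finally show ?thesis .
qed

text \<open>Second-moment computation: \<open>X\<close> is a sum of indicators, and its square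
  involves only pairs of points, so pairwise independence determines the variance.\<close>

lemma pairwise_independent_count:
  fixes R :: "'g \<Rightarrow> 'x \<Rightarrow> bool" and p :: real and X :: "'x \<Rightarrow> real"
  assumes A: "finite A" "A \<noteq> {}" and G: "finite G"
    and single: "\<And>\<gamma>. \<gamma> \<in> G \<Longrightarrow> real (card {x \<in> A. R \<gamma> x}) = p * card A"
    and joint: "\<And>\<gamma> \<delta>. \<gamma> \<in> G \<Longrightarrow> \<delta> \<in> G \<Longrightarrow> \<gamma> \<noteq> \<delta> \<Longrightarrow>
      real (card {x \<in> A. R \<gamma> x \<and> R \<delta> x}) = p\<^sup>2 * card A"
    and X: "\<And>x. X x = real (card {\<gamma> \<in> G. R \<gamma> x})"
  shows "measure_pmf.expectation (pmf_of_set A) X = card G * p"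
    and "measure_pmf.variance (pmf_of_set A) X = card G * p * (1 - p)"
proof -
  have cA: "real (card A) > 0" using A by (simp add: card_gt_0_iff)
  have X': "X x = (\<Sum>\<gamma>\<in>G. of_bool (R \<gamma> x))" for x
    using G by (simp add: X sum.If_cases of_bool_def Int_def)
  have int: "integrable (measure_pmf (pmf_of_set A)) h" for h :: "'x \<Rightarrow> real"
    using A by (intro integrable_measure_pmf_finite) simp
  have cnt: "(\<Sum>x\<in>A. of_bool (Q x)) = real (card {x \<in> A. Q x})" for Q
    using A by (simp add: sum.If_cases of_bool_def Int_def)
  have "(\<Sum>x\<in>A. X x) = (\<Sum>\<gamma>\<in>G. \<Sum>x\<in>A. of_bool (R \<gamma> x))"
    unfolding X' by (rule sum.swap)
  also have "\<dots> = card G * p * card A"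
    by (simp add: cnt single)
  finally show E: "measure_pmf.expectation (pmf_of_set A) X = card G * p"
    using A cA by (simp add: integral_pmf_of_set)
  have "(\<Sum>x\<in>A. (X x)\<^sup>2) = (\<Sum>x\<in>A. \<Sum>\<gamma>\<in>G. \<Sum>\<delta>\<in>G. of_bool (R \<gamma> x \<and> R \<delta> x))"
    unfolding X' power2_eq_square sum_product
    by (intro sum.cong refl) auto
  also have "\<dots> = (\<Sum>\<gamma>\<in>G. \<Sum>x\<in>A. \<Sum>\<delta>\<in>G. of_bool (R \<gamma> x \<and> R \<delta> x))"
    by (rule sum.swap)
  also have "\<dots> = (\<Sum>\<gamma>\<in>G. \<Sum>\<delta>\<in>G. \<Sum>x\<in>A. of_bool (R \<gamma> x \<and> R \<delta> x))"
    by (intro sum.cong refl sum.swap)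
  \<comment> \<open>A diagonal pair contributes \<open>p * card A\<close> instead of
    \<open>p\<^sup>2 * card A\<close>; writing this as a correction at
    \<open>\<delta> = \<gamma>\<close> lets the inner sum collapse.\<close>
  also have "\<dots> = (\<Sum>\<gamma>\<in>G. \<Sum>\<delta>\<in>G. p\<^sup>2 * card A + of_bool (\<delta> = \<gamma>) * ((p - p\<^sup>2) * card A))"
    unfolding cnt by (intro sum.cong refl) (auto simp: single joint algebra_simps)
  also have "\<dots> = (\<Sum>\<gamma>\<in>G. card G * (p\<^sup>2 * card A) + (p - p\<^sup>2) * card A)"
    using G by (intro sum.cong refl) (simp add: sum.distrib flip: sum_distrib_right)
  also have "\<dots> = (card G * (card G * p\<^sup>2 + (p - p\<^sup>2))) * card A"
    by (simp add: algebra_simps)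
  finally have "measure_pmf.expectation (pmf_of_set A) (\<lambda>x. (X x)\<^sup>2)
      = card G * (card G * p\<^sup>2 + (p - p\<^sup>2))"
    using A cA by (simp add: integral_pmf_of_set)
  then show "measure_pmf.variance (pmf_of_set A) X = card G * p * (1 - p)"
    by (subst measure_pmf.variance_eq[OF int int], unfold E)
       (simp add: power2_eq_square algebra_simps)
qed

section \<open>Coprime pairs of monic univariate polynomials\<close>

lemma coprime_smult_iff:
  fixes p q :: "'a::field poly"
  assumes "a \<noteq> 0" "b \<noteq> 0"
  shows "coprime (smult a p) (smult b q) \<longleftrightarrow> coprime p q"
  using assms by (simp add: coprime_def dvd_smult_iff)

text \<open>Euclid's algorithm: passing from \<open>(p, q)\<close> to \<open>(q, p mod q)\<close>
  keeps coprimality and shrinks the second entry; the relation is pulled back along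
  \<open>p mod q = p - (p div q) * q\<close>.\<close>

lemma coprime_poly_bezout:
  fixes p q :: "'a::field poly"
  assumes "coprime p q"
  shows "\<exists>a b. a * p + b * q = 1"
  using assms
proof (induction "euclidean_size q" arbitrary: p q rule: less_induct)
  case less
  show ?case
  proof (cases "q = 0")
    case True
    then have "p dvd 1" using less.prems by auto
    then obtain c where "1 = p * c" ..
    then have "c * p + 0 * q = 1" by (simp add: mult.commute)
    then show ?thesis by blast
  next
    case False
    have "coprime q (p mod q)"
      using less.prems by (auto simp: coprime_def dvd_mod_iff)
    then obtain a b where ab: "a * q + b * (p mod q) = 1"
      using less.hyps[of "p mod q" q] mod_size_less[OF False] by blast
    have "b * p + (a - b * (p div q)) * q = a * q + b * (p - (p div q) * q)"
      by (simp add: algebra_simps)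
    also have "\<dots> = 1" using ab by (simp add: minus_div_mult_eq_mod)
    finally show ?thesis by blast
  qed
qed

section \<open>Monic polynomials and factorization through the monic gcd\<close>

definition monics :: "nat \<Rightarrow> 'a::field poly set" where
  "monics k = {p. degree p = k \<and> lead_coeff p = 1}"

lemma monics_0: "monics 0 = {1}"
  by (auto simp: monics_def elim!: degree_eq_zeroE)

text \<open>Stripping the constant coefficient, which is arbitrary, makes finiteness and the count
  inductions on the degree.\<close>

lemma monics_Suc: "monics (Suc k) = (\<lambda>(a, p). pCons a p) ` (UNIV \<times> monics k)"
proof (intro set_eqI iffI)
  fix p :: "'a poly"
  assume p: "p \<in> monics (Suc k)"
  obtain a r where "p = pCons a r" by (cases p)
  with p show "p \<in> (\<lambda>(a, p). pCons a p) ` (UNIV \<times> monics k)"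
    by (auto simp: monics_def split: if_splits)
qed (auto simp: monics_def)

lemma finite_monics: "finite (monics k :: 'a::{finite,field} poly set)"
  by (induction k) (auto simp: monics_0 monics_Suc)

lemma card_monics: "card (monics k :: 'a::{finite,field} poly set) = CARD('a) ^ k"
proof (induction k)
  case (Suc k)
  have "inj_on (\<lambda>(a, p). pCons a p) (UNIV \<times> monics k :: ('a \<times> 'a poly) set)"
    by (auto simp: inj_on_def)
  then show ?case
    by (simp add: monics_Suc card_image card_cartesian_product Suc)
qed (simp add: monics_0)

text \<open>The cofactor has degree 0 and leading coefficient 1, so it is 1.\<close>

lemma monic_dvd_antisym:
  fixes p q :: "'a::field poly"
  assumes "lead_coeff p = 1" "lead_coeff q = 1" "p dvd q" "q dvd p"
  shows "p = q"
proof -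
  obtain r where r: "q = p * r" using assms(3) by blast
  have nz: "p \<noteq> 0" "q \<noteq> 0" "r \<noteq> 0" using assms r by auto
  have "degree q \<le> degree p" using assms(4) nz by (simp add: dvd_imp_degree_le)
  then have "degree r = 0" using r nz by (simp add: degree_mult_eq)
  moreover have "lead_coeff r = 1" using r assms by (simp add: lead_coeff_mult)
  ultimately show ?thesis using r by (auto elim!: degree_eq_zeroE)
qed

text \<open>Uniqueness of the gcd decomposition. If \<open>a * p + b * q = 1\<close>, then
  \<open>d\<close> is a combination of \<open>d * p\<close> and \<open>d * q\<close>, both multiples
  of \<open>e\<close>; by symmetry \<open>d\<close> and \<open>e\<close> divide each other.\<close>

lemma monic_gcd_unique:
  fixes d e :: "'a::field poly"
  assumes "lead_coeff d = 1" "lead_coeff e = 1" "coprime p q" "coprime p' q'"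
    and "d * p = e * p'" "d * q = e * q'"
  shows "d = e"
proof -
  have *: "e dvd d" if H: "coprime p q" "d * p = e * p'" "d * q = e * q'" for d e p q p' q' :: "'a poly"
  proof -
    obtain a b where "a * p + b * q = 1" using coprime_poly_bezout[OF H(1)] by blast
    then have "d = d * (a * p + b * q)" by simp
    also have "\<dots> = a * (d * p) + b * (d * q)" by (simp add: algebra_simps)
    also have "\<dots> = e * (a * p' + b * q')" unfolding H by (simp add: algebra_simps)
    finally show ?thesis by simp
  qed
  show ?thesis
    using *[OF assms(3,5,6)] *[OF assms(4) assms(5)[symmetric] assms(6)[symmetric]] assms(1,2)
    by (intro monic_dvd_antisym) auto
qed

lemma monic_factor_monic:
  fixes d p :: "'a::field poly"
  assumes "d * p \<in> monics k" "d \<in> monics j"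
  shows "j \<le> k \<and> p \<in> monics (k - j)"
proof -
  have "d \<noteq> 0" "p \<noteq> 0" using assms by (auto simp: monics_def)
  then show ?thesis using assms by (auto simp: monics_def degree_mult_eq coeff_mult_degree_sum)
qed

lemma monic_mult_monic:
  fixes d p :: "'a::field poly"
  assumes "d \<in> monics j" "p \<in> monics k"
  shows "d * p \<in> monics (j + k)"
proof -
  have "d \<noteq> 0" "p \<noteq> 0" using assms by (auto simp: monics_def)
  then show ?thesis using assms by (auto simp: monics_def degree_mult_eq coeff_mult_degree_sum)
qed

definition coprime_monics :: "nat \<Rightarrow> nat \<Rightarrow> ('a::field poly \<times> 'a poly) set" where
  "coprime_monics l m = {w \<in> monics l \<times> monics m. coprime (fst w) (snd w)}"

text \<open>A monic common divisor of maximal degree serves as the gcd; it exists because degrees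
  are bounded by that of \<open>u\<close>.\<close>

lemma monic_pair_gcd_decomposition:
  fixes u v :: "'a::field poly"
  assumes "u \<in> monics l" "v \<in> monics m"
  shows "\<exists>k\<le>min l m. \<exists>d\<in>monics k. \<exists>(p, q)\<in>coprime_monics (l - k) (m - k). u = d * p \<and> v = d * q"
proof -
  define S where "S = {d. lead_coeff d = 1 \<and> d dvd u \<and> d dvd v}"
  have u0: "u \<noteq> 0" using assms by (auto simp: monics_def)
  have "1 \<in> S" by (simp add: S_def)
  moreover have "degree d \<le> degree u" if "d \<in> S" for d
    using that u0 by (auto simp: S_def dvd_imp_degree_le)
  ultimately have "\<exists>d. d \<in> S \<and> (\<forall>e. e \<in> S \<longrightarrow> degree e \<le> degree d)"
    by (intro ex_has_greatest_nat[of _ 1 degree "Suc (degree u)"]) (auto simp: less_Suc_eq_le)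
  then obtain d where d: "d \<in> S" and max: "\<And>e. e \<in> S \<Longrightarrow> degree e \<le> degree d"
    by auto
  obtain p q where pq: "u = d * p" "v = d * q" using d unfolding S_def by (blast elim: dvdE)
  have dm: "d \<in> monics (degree d)" using d by (simp add: S_def monics_def)
  have pm: "degree d \<le> l \<and> p \<in> monics (l - degree d)" "degree d \<le> m \<and> q \<in> monics (m - degree d)"
    using assms pq dm monic_factor_monic by blast+
  have "coprime p q"
  proof (rule coprimeI)
    fix e assume e: "e dvd p" "e dvd q"
    have e0: "e \<noteq> 0" using e u0 pq by auto
    \<comment> \<open>After normalization \<open>d * e'\<close> is again a monic common divisor of
      \<open>u\<close> and \<open>v\<close>, so maximality of \<open>degree d\<close> forces
      \<open>e\<close> to be constant.\<close>
    define e' where "e' = smult (inverse (lead_coeff e)) e"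
    have e': "lead_coeff e' = 1" "degree e' = degree e" "e' dvd p" "e' dvd q"
      using e0 e by (auto simp: e'_def smult_dvd_iff)
    then have "d * e' \<in> S" using d unfolding S_def pq by (auto simp: lead_coeff_mult)
    from max[OF this] have "degree e = 0"
      using e' d e0 by (subst (asm) degree_mult_eq) (auto simp: S_def)
    then show "is_unit e" using e0 by (auto simp: is_unit_iff_degree)
  qed
  then show ?thesis
    using pm dm pq by (intro exI[of _ "degree d"] conjI bexI[of _ d] bexI[of _ "(p, q)"])
      (auto simp: coprime_monics_def)
qed

text \<open>Sending \<open>(k, d, p, q)\<close> to \<open>(d * p, d * q)\<close> is a bijection onto
  all monic pairs, and there are \<open>CARD('a) ^ k\<close> choices of \<open>d\<close> of degree
  \<open>k\<close>.\<close>

lemma card_monic_pairs_by_gcd: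
  "CARD('a::{finite,field}) ^ (l + m) =
    (\<Sum>k\<le>min l m. CARD('a) ^ k * card (coprime_monics (l - k) (m - k) :: ('a poly \<times> 'a poly) set))"
proof -
  define S :: "nat \<Rightarrow> ('a poly \<times> 'a poly \<times> 'a poly) set"
    where "S k = monics k \<times> coprime_monics (l - k) (m - k)" for k
  define T where "T = (SIGMA k:{..min l m}. S k)"
  define \<phi> :: "nat \<times> 'a poly \<times> 'a poly \<times> 'a poly \<Rightarrow> 'a poly \<times> 'a poly"
    where "\<phi> = (\<lambda>(k, d, p, q). (d * p, d * q))"
  have fin: "finite (S k)" for k
    by (auto simp: S_def coprime_monics_def finite_monics)
  have "inj_on \<phi> T"
  proof (rule inj_onI)
    fix s t assume st: "s \<in> T" "t \<in> T" "\<phi> s = \<phi> t"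
    obtain k d p q k' d' p' q' where s: "s = (k, d, p, q)" and t: "t = (k', d', p', q')"
      by (metis prod.collapse)
    have eq: "d * p = d' * p'" "d * q = d' * q'" using st s t by (auto simp: \<phi>_def)
    have "d = d'"
      using st eq unfolding s t
      by (intro monic_gcd_unique[OF _ _ _ _ eq]) (auto simp: T_def S_def coprime_monics_def monics_def)
    \<comment> \<open>A nonzero \<open>d\<close> cancels from both products, and \<open>k\<close> is
      recovered as its degree.\<close>
    moreover have "d \<noteq> 0" using st s by (auto simp: T_def S_def monics_def)
    ultimately show "s = t" using st eq unfolding s t by (auto simp: T_def S_def monics_def)
  qed
  moreover have "\<phi> ` T = monics l \<times> monics m"
  proof (intro set_eqI iffI)
    fix w assume "w \<in> \<phi> ` T"
    then obtain k d p q where *: "k \<le> l" "k \<le> m" "d \<in> monics k" "p \<in> monics (l - k)"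
        "q \<in> monics (m - k)" "w = (d * p, d * q)"
      by (auto simp: \<phi>_def T_def S_def coprime_monics_def)
    have "d * p \<in> monics (k + (l - k))" "d * q \<in> monics (k + (m - k))"
      using * by (simp_all only: monic_mult_monic)
    with * show "w \<in> monics l \<times> monics m" by simp
  next
    fix w :: "'a poly \<times> 'a poly" assume "w \<in> monics l \<times> monics m"
    then obtain k d p q where *: "k \<le> min l m" "d \<in> monics k" "(p, q) \<in> coprime_monics (l - k) (m - k)"
        "w = (d * p, d * q)"
      using monic_pair_gcd_decomposition[of "fst w" l "snd w" m] by force
    then have "(k, d, p, q) \<in> T" by (auto simp: T_def S_def)
    moreover have "w = \<phi> (k, d, p, q)" using * by (simp add: \<phi>_def)
    ultimately show "w \<in> \<phi> ` T" by blast
  qed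
  ultimately have "card (monics l \<times> monics m :: ('a poly \<times> 'a poly) set) = card T"
    by (metis card_image)
  also have "\<dots> = (\<Sum>k\<le>min l m. card (S k))"
    unfolding T_def using fin by (intro card_SigmaI) auto
  finally show ?thesis by (simp add: S_def card_cartesian_product card_monics power_add)
qed

definition noncoprime_monics :: "nat \<Rightarrow> nat \<Rightarrow> ('a::field poly \<times> 'a poly) set" where
  "noncoprime_monics l m = {w \<in> monics l \<times> monics m. \<not> coprime (fst w) (snd w)}"

text \<open>
  The terms with \<open>k > 0\<close> in the sum of \<open>card_monic_pairs_by_gcd\<close> add up to \<open>q\<close> times the
  whole sum for \<open>l - 1\<close> and \<open>m - 1\<close>, so no induction is needed.
\<close>

lemma card_noncoprime_monics:
  assumes "l > 0" "m > 0"
  shows "CARD('a) * card (noncoprime_monics l m :: ('a::{finite,field} poly \<times> 'a poly) set)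
    = CARD('a) ^ (l + m)"
proof -
  obtain l' m' where lm: "l = Suc l'" "m = Suc m'" using assms by (metis gr0_implies_Suc)
  let ?q = "CARD('a)" and ?C = "\<lambda>l m. card (coprime_monics l m :: ('a poly \<times> 'a poly) set)"
  have "?q ^ (l + m) = ?C l m + (\<Sum>k\<le>min l' m'. ?q ^ Suc k * ?C (l' - k) (m' - k))"
    by (subst card_monic_pairs_by_gcd) (simp add: lm sum.atMost_Suc_shift del: sum.atMost_Suc)
  \<comment> \<open>The counting identity is applied a second time, now at \<open>l'\<close> and
    \<open>m'\<close>, which may be 0.\<close>
  also have "(\<Sum>k\<le>min l' m'. ?q ^ Suc k * ?C (l' - k) (m' - k)) = ?q * ?q ^ (l' + m')"
    by (subst card_monic_pairs_by_gcd) (simp add: sum_distrib_left mult.assoc)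
  finally have 1: "?q ^ (l + m) = ?C l m + ?q * ?q ^ (l' + m')" .
  have "?q ^ (l + m) = card (monics l \<times> monics m :: ('a poly \<times> 'a poly) set)"
    by (simp add: card_cartesian_product card_monics power_add)
  also have "monics l \<times> monics m =
      (coprime_monics l m \<union> noncoprime_monics l m :: ('a poly \<times> 'a poly) set)"
    by (auto simp: coprime_monics_def noncoprime_monics_def)
  also have "card \<dots> = ?C l m + card (noncoprime_monics l m :: ('a poly \<times> 'a poly) set)"
    by (intro card_Un_disjoint) (auto simp: coprime_monics_def noncoprime_monics_def finite_monics)
  finally show ?thesis using 1 by (simp add: lm)
qed

section \<open>Specialization\<close>

definition monomial_eval :: "(nat \<Rightarrow> 'b::comm_semiring_1) \<Rightarrow> (nat \<Rightarrow>\<^sub>0 nat) \<Rightarrow> 'b" where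
  "monomial_eval s t = (\<Prod>i\<in>Poly_Mapping.keys t. s i ^ Poly_Mapping.lookup t i)"

text \<open>Exponents outside the support are 0 and give the factor 1; a common index set allows
  \<open>t\<close>, \<open>t'\<close> and \<open>t + t'\<close> to be compared factor by
  factor.\<close>

lemma monomial_eval_superset:
  assumes "finite I" "Poly_Mapping.keys t \<subseteq> I"
  shows "monomial_eval s t = (\<Prod>i\<in>I. s i ^ Poly_Mapping.lookup t i)"
  unfolding monomial_eval_def using assms
  by (intro prod.mono_neutral_left) (auto simp: in_keys_iff)

lemma monomial_eval_add: "monomial_eval s (t + t') = monomial_eval s t * monomial_eval s t'"
proof -
  let ?I = "Poly_Mapping.keys t \<union> Poly_Mapping.keys t'"
  have "monomial_eval s (t + t') = (\<Prod>i\<in>?I. s i ^ Poly_Mapping.lookup (t + t') i)"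
    by (intro monomial_eval_superset) (simp_all add: Poly_Mapping.keys_add)
  moreover have "monomial_eval s t = (\<Prod>i\<in>?I. s i ^ Poly_Mapping.lookup t i)"
    by (intro monomial_eval_superset) auto
  moreover have "monomial_eval s t' = (\<Prod>i\<in>?I. s i ^ Poly_Mapping.lookup t' i)"
    by (intro monomial_eval_superset) auto
  ultimately show ?thesis
    by (simp add: lookup_add power_add prod.distrib)
qed

text \<open>Reduces additive statements to single terms: updating at a key outside the support is
  the same as adding a single term.\<close>

lemma poly_mapping_induct [case_names zero single_add]:
  fixes p :: "'k \<Rightarrow>\<^sub>0 'v::comm_monoid_add"
  assumes "P 0" "\<And>k v p. P p \<Longrightarrow> P (Poly_Mapping.single k v + p)"
  shows "P p"
proof (induction p rule: update_induct)
  case (update f a b)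
  have "Poly_Mapping.update a b f = Poly_Mapping.single a b + f"
    using update(1)
    by (intro poly_mapping_eqI) (auto simp: lookup_update lookup_add lookup_single when_def in_keys_iff)
  then show ?case using assms(2) update by simp
qed (rule assms(1))

lemma prod_const_poly: "(\<Prod>i\<in>I. [:f i:]) = [:\<Prod>i\<in>I. f i:]"
  by (induction I rule: infinite_finite_induct) (auto simp: one_pCons mult.commute)

context
  fixes \<gamma> :: "nat \<Rightarrow> 'a::comm_semiring_1"
begin

private abbreviation "subst \<equiv> (\<lambda>i. if i = 1 then [:0, 1:] else [:\<gamma> i:])"

lemma specialize_superset:
  assumes "finite T" "Poly_Mapping.keys p \<subseteq> T"
  shows "specialize \<gamma> p = (\<Sum>t\<in>T. smult (Poly_Mapping.lookup p t) (monomial_eval subst t))"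
  unfolding specialize_def mp_eval_def monomial_eval_def[symmetric] using assms
  by (simp, intro sum.mono_neutral_left) (auto simp: in_keys_iff)

lemma specialize_single: "specialize \<gamma> (Poly_Mapping.single t a) = smult a (monomial_eval subst t)"
  by (subst specialize_superset[of "{t}"]) auto

lemma specialize_0: "specialize \<gamma> 0 = 0"
  by (subst specialize_superset[of "{}"]) auto

lemma specialize_add: "specialize \<gamma> (p + r) = specialize \<gamma> p + specialize \<gamma> r"
proof -
  let ?T = "Poly_Mapping.keys p \<union> Poly_Mapping.keys r"
  have "Poly_Mapping.keys (p + r) \<subseteq> ?T" by (rule Poly_Mapping.keys_add)
  then show ?thesis
    by (simp add: specialize_superset[of ?T] lookup_add smult_add_left sum.distrib)
qed

text \<open>Both sides are additive in each factor, so two inductions reduce the claim to monomials,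
  where exponents add.\<close>

lemma specialize_mult: "specialize \<gamma> (p * r) = specialize \<gamma> p * specialize \<gamma> r"
proof (induction p rule: poly_mapping_induct)
  case zero
  show ?case by (simp add: specialize_0)
next
  case (single_add t a p)
  have "specialize \<gamma> (Poly_Mapping.single t a * r) = specialize \<gamma> (Poly_Mapping.single t a) * specialize \<gamma> r"
  proof (induction r rule: poly_mapping_induct)
    case zero
    show ?case by (simp add: specialize_0)
  next
    case (single_add t' b r)
    then show ?case
      by (simp add: mult_single specialize_single specialize_add distrib_left monomial_eval_add mult.commute)
  qed
  with single_add show ?case by (simp add: distrib_right specialize_add)
qed

lemma specialize_const: "specialize \<gamma> (mp_const a) = [:a:]"
  by (simp add: mp_const_def specialize_single monomial_eval_def)

lemma specialize_x: "specialize \<gamma> (mp_x i) = (if i = 1 then [:0, 1:] else [:\<gamma> i:])"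
  by (simp add: mp_x_def specialize_single monomial_eval_def)

lemma specialize_power: "specialize \<gamma> (p ^ k) = specialize \<gamma> p ^ k"
proof (induction k)
  case 0
  show ?case using specialize_const[of 1] by (simp add: mp_const_def one_pCons)
qed (simp add: specialize_mult)

lemma specialize_sum: "specialize \<gamma> (sum f I) = (\<Sum>i\<in>I. specialize \<gamma> (f i))"
  by (induction I rule: infinite_finite_induct) (auto simp: specialize_0 specialize_add)

lemma specialize_form:
  "specialize \<gamma> (C * mp_x 1 ^ i) = specialize \<gamma> C * monom 1 i"
  by (simp add: specialize_mult specialize_power specialize_x flip: monom_altdef)
     (simp add: monom_altdef)

text \<open>Every indeterminate other than the first becomes a constant, hence so does each monomial
  of \<open>C\<close>.\<close>

lemma degree_specialize_coeff:
  assumes "1 \<notin> mp_vars C"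
  shows "degree (specialize \<gamma> C) = 0"
proof -
  have "degree (monomial_eval subst t) = 0" if "t \<in> Poly_Mapping.keys C" for t
  proof -
    have "1 \<notin> Poly_Mapping.keys t" using that assms by (auto simp: mp_vars_def)
    then have "monomial_eval subst t = (\<Prod>i\<in>Poly_Mapping.keys t. [:\<gamma> i ^ Poly_Mapping.lookup t i:])"
      unfolding monomial_eval_def by (intro prod.cong refl) (auto simp: poly_const_pow)
    also have "\<dots> = [:\<Prod>i\<in>Poly_Mapping.keys t. \<gamma> i ^ Poly_Mapping.lookup t i:]"
      by (rule prod_const_poly)
    finally show ?thesis by simp
  qed
  then show ?thesis
    using degree_sum_le[of "Poly_Mapping.keys C"
        "\<lambda>t. smult (Poly_Mapping.lookup C t) (monomial_eval subst t)" 0]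
      degree_smult_le order.trans
    by (subst specialize_superset[of "Poly_Mapping.keys C"]) fastforce+
qed

end

section \<open>Distribution of the specializations\<close>

definition coeff_polys :: "nat \<Rightarrow> nat \<Rightarrow> 'a::zero mp set" where
  "coeff_polys n j = {C. mp_vars C \<subseteq> {2..n} \<and> total_degree_le C j}"

text \<open>Two nested finiteness arguments: bounded exponents on \<open>{2..n}\<close> leave
  finitely many monomials, and each takes finitely many coefficients.\<close>

lemma finite_coeff_polys: "finite (coeff_polys n j :: 'a::{finite,zero} mp set)"
proof -
  define T where "T = {t :: nat \<Rightarrow>\<^sub>0 nat. Poly_Mapping.keys t \<subseteq> {2..n} \<and>
    (\<Sum>i\<in>Poly_Mapping.keys t. Poly_Mapping.lookup t i) \<le> j}"
  have inj: "inj_on Poly_Mapping.lookup S" for S :: "('k \<Rightarrow>\<^sub>0 'v::zero) set"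
    by (auto simp: inj_on_def poly_mapping_eqI)
  have le: "Poly_Mapping.lookup t i \<le> j" if "t \<in> T" for t i
  proof (cases "i \<in> Poly_Mapping.keys t")
    case True
    then have "Poly_Mapping.lookup t i \<le> (\<Sum>i\<in>Poly_Mapping.keys t. Poly_Mapping.lookup t i)"
      by (intro member_le_sum) auto
    then show ?thesis using that by (simp add: T_def)
  qed (simp add: in_keys_iff)
  have "Poly_Mapping.lookup ` T \<subseteq>
      {f. \<forall>i. (i \<in> {2..n} \<longrightarrow> f i \<in> {..j}) \<and> (i \<notin> {2..n} \<longrightarrow> f i = 0)}"
    using le by (auto simp: T_def in_keys_iff)
  moreover have "finite {f. \<forall>i. (i \<in> {2..n} \<longrightarrow> f i \<in> {..j}) \<and> (i \<notin> {2..n} \<longrightarrow> f i = (0::nat))}"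
    by (intro finite_set_of_finite_funs) auto
  ultimately have T: "finite T"
    by (intro finite_imageD[OF finite_subset inj])
  have "Poly_Mapping.keys C \<subseteq> T" if "C \<in> coeff_polys n j" for C :: "'a mp"
    using that by (auto simp: coeff_polys_def T_def mp_vars_def total_degree_le_def)
  then have "Poly_Mapping.lookup ` (coeff_polys n j :: 'a mp set) \<subseteq>
      {f. \<forall>t. (t \<in> T \<longrightarrow> f t \<in> UNIV) \<and> (t \<notin> T \<longrightarrow> f t = 0)}"
    by (auto simp: subset_iff in_keys_iff)
  moreover have "finite {f. \<forall>t. (t \<in> T \<longrightarrow> f t \<in> UNIV) \<and> (t \<notin> T \<longrightarrow> f t = (0::'a))}"
    by (intro finite_set_of_finite_funs T) auto
  ultimately show ?thesis
    by (intro finite_imageD[OF finite_subset inj])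
qed

lemma coeff_polys_keys_subset:
  assumes "C \<in> coeff_polys n j" "Poly_Mapping.keys D \<subseteq> Poly_Mapping.keys C"
  shows "D \<in> coeff_polys n j"
  using assms by (fastforce simp: coeff_polys_def mp_vars_def total_degree_le_def)

lemma coeff_polys_add:
  assumes "C \<in> coeff_polys n j" "D \<in> coeff_polys n j"
  shows "C + D \<in> coeff_polys n j"
  using assms Poly_Mapping.keys_add[of C D]
  by (fastforce simp: coeff_polys_def mp_vars_def total_degree_le_def)

lemma coeff_polys_const_mult:
  assumes "C \<in> coeff_polys n j"
  shows "mp_const a * C \<in> coeff_polys n j"
  using keys_mult[of "mp_const a" C]
  by (intro coeff_polys_keys_subset[OF assms]) (auto simp: mp_const_def split: if_splits)

lemma coeff_polys_const: "mp_const a \<in> coeff_polys n j"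
  by (auto simp: coeff_polys_def mp_const_def mp_vars_def total_degree_le_def)

text \<open>Makes linear terms available for every power \<open>i < l\<close>, where the bound
  \<open>l - i\<close> is positive.\<close>

lemma coeff_polys_x:
  assumes "k \<in> {2..n}" "j > 0"
  shows "mp_x k \<in> (coeff_polys n j :: 'a::zero_neq_one mp set)"
  using assms by (auto simp: coeff_polys_def mp_x_def mp_vars_def total_degree_le_def)

lemma specialize_coeff_polys:
  assumes "C \<in> coeff_polys n j"
  shows "specialize \<gamma> C = [:coeff (specialize \<gamma> C) 0:]"
proof -
  have "1 \<notin> mp_vars C" using assms by (auto simp: coeff_polys_def)
  then have "degree (specialize \<gamma> C) = 0" by (rule degree_specialize_coeff)
  then show ?thesis by (metis degree_eq_zeroE coeff_pCons_0)
qed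

lemma mp_const_mult: "mp_const a * mp_const b = mp_const (a * b :: 'a::semiring_0)"
  by (simp add: mp_const_def mult_single)

definition form :: "nat \<Rightarrow> 'a::field \<Rightarrow> (nat \<Rightarrow> 'a mp) \<Rightarrow> 'a mp" where
  "form l c C = mp_const c * mp_x 1 ^ l + (\<Sum>i<l. C (l - i) * mp_x 1 ^ i)"

lemma form_polysI:
  assumes "c \<noteq> 0" "\<And>i. i < l \<Longrightarrow> C (l - i) \<in> coeff_polys n (l - i)"
  shows "form l c C \<in> form_polys n l"
  using assms unfolding form_polys_def form_def coeff_polys_def by blast

lemma form_polysD:
  assumes "f \<in> form_polys n l"
  shows "\<exists>c C. f = form l c C \<and> c \<noteq> 0 \<and> (\<forall>i<l. C (l - i) \<in> coeff_polys n (l - i))"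
  using assms unfolding form_polys_def form_def coeff_polys_def by blast

lemma finite_form_polys: "finite (form_polys n l :: 'a::{finite,field} mp set)"
proof (rule finite_subset)
  show "form_polys n l \<subseteq>
      (\<lambda>(c, C). form l c C) ` (UNIV \<times> PiE {1..l} (coeff_polys n) :: ('a \<times> (nat \<Rightarrow> 'a mp)) set)"
  proof
    fix f :: "'a mp" assume "f \<in> form_polys n l"
    then obtain c C where f: "f = form l c C" "\<And>i. i < l \<Longrightarrow> C (l - i) \<in> coeff_polys n (l - i)"
      using form_polysD by blast
    \<comment> \<open>The bounds \<open>l - i\<close> with \<open>i < l\<close> are exactly the
      indices \<open>1..l\<close>, so restricting \<open>C\<close> to them leaves the form
      unchanged.\<close>
    have "C j \<in> coeff_polys n j" if "j \<in> {1..l}" for j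
      using f(2)[of "l - j"] that by simp
    then have "(c, restrict C {1..l}) \<in> UNIV \<times> PiE {1..l} (coeff_polys n)" by simp
    moreover have "f = (\<lambda>(c, C). form l c C) (c, restrict C {1..l})"
      by (auto simp: f(1) form_def intro!: sum.cong)
    ultimately show "f \<in> (\<lambda>(c, C). form l c C) ` (UNIV \<times> PiE {1..l} (coeff_polys n))"
      by (rule rev_image_eqI)
  qed
  show "finite ((\<lambda>(c, C). form l c C) ` (UNIV \<times> PiE {1..l} (coeff_polys n) :: ('a \<times> (nat \<Rightarrow> 'a mp)) set))"
    by (intro finite_imageI finite_cartesian_product finite_PiE finite_coeff_polys) auto
qed

lemma form_polys_nonempty: "form_polys n l \<noteq> {}"
  using form_polysI[of 1 l "\<lambda>_. mp_const 0" n] coeff_polys_const by auto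

lemma specialize_lower_terms:
  assumes "\<And>i. i < l \<Longrightarrow> D i \<in> coeff_polys n (l - i)"
  shows "specialize \<gamma> (\<Sum>i<l. D i * mp_x 1 ^ i) = (\<Sum>i<l. monom (coeff (specialize \<gamma> (D i)) 0) i)"
proof -
  have "specialize \<gamma> (D i * mp_x 1 ^ i) = monom (coeff (specialize \<gamma> (D i)) 0) i" if "i < l" for i
    by (subst specialize_form, subst specialize_coeff_polys[OF assms[OF that]]) (simp add: smult_monom)
  then show ?thesis by (simp add: specialize_sum)
qed

text \<open>The quantifier order matters: \<open>c\<close> is the constant coefficient of the top
  power of \<open>x_1\<close>, hence the same at every point.\<close>

lemma specialize_form_polys:
  assumes "f \<in> form_polys n l"
  shows "\<exists>c. c \<noteq> 0 \<and> (\<forall>\<gamma>. \<exists>u\<in>monics l. specialize \<gamma> f = smult c u)"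
proof -
  obtain c C where f: "f = form l c C" "c \<noteq> 0" "\<And>i. i < l \<Longrightarrow> C (l - i) \<in> coeff_polys n (l - i)"
    using form_polysD[OF assms] by blast
  have "\<exists>u\<in>monics l. specialize \<gamma> f = smult c u" for \<gamma>
  proof
    have "specialize \<gamma> f = monom c l + (\<Sum>i<l. monom (coeff (specialize \<gamma> (C (l - i))) 0) i)"
      unfolding f(1) form_def
      by (simp only: specialize_add specialize_form specialize_const specialize_lower_terms[OF f(3)])
         (simp add: smult_monom)
    then have co: "coeff (specialize \<gamma> f) l = c" "\<And>i. i > l \<Longrightarrow> coeff (specialize \<gamma> f) i = 0"
      by (simp_all add: coeff_sum)
    have "degree (specialize \<gamma> f) = l"
      using co f(2) by (intro antisym degree_le le_degree) auto
    then show "smult (inverse c) (specialize \<gamma> f) \<in> monics l"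
      using co f(2) by (simp add: monics_def)
    show "specialize \<gamma> f = smult c (smult (inverse c) (specialize \<gamma> f))" using f(2) by simp
  qed
  then show ?thesis using f(2) by blast
qed

section \<open>Interpolation at two points and the size of fibres\<close>

lemma sum_monom_coeff:
  assumes "\<And>i. i \<ge> l \<Longrightarrow> coeff p i = 0"
  shows "(\<Sum>i<l. monom (coeff p i) i) = p"
  using assms by (intro poly_eqI) (auto simp: coeff_sum not_less)

text \<open>
  Linear forms \<open>a + b x\<^sub>k\<close> are allowed as coefficients of all \<open>x\<^sub>1\<^sup>i\<close>, \<open>i < l\<close>, and they
  already interpolate arbitrary values at two points with distinct \<open>k\<close>-th coordinates.
\<close>

lemma specialize_interpolate:
  fixes p r :: "'a::field poly"
  assumes k: "k \<in> {2..n}" "\<gamma> k \<noteq> \<delta> k"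
    and deg: "\<And>i. i \<ge> l \<Longrightarrow> coeff p i = 0" "\<And>i. i \<ge> l \<Longrightarrow> coeff r i = 0"
  shows "\<exists>H. (\<forall>i<l. H i \<in> coeff_polys n (l - i)) \<and>
    specialize \<gamma> (\<Sum>i<l. H i * mp_x 1 ^ i) = p \<and> specialize \<delta> (\<Sum>i<l. H i * mp_x 1 ^ i) = r"
proof -
  \<comment> \<open>\<open>b i\<close> and \<open>a i\<close> are slope and intercept of the line
    through \<open>(\<gamma> k, coeff p i)\<close> and
    \<open>(\<delta> k, coeff r i)\<close>.\<close>
  define b where "b i = (coeff p i - coeff r i) / (\<gamma> k - \<delta> k)" for i
  define a where "a i = coeff p i - b i * \<gamma> k" for i
  define H where "H i = mp_const (a i) + mp_const (b i) * mp_x k" for i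
  have mem: "H i \<in> coeff_polys n (l - i)" if "i < l" for i
    using that k unfolding H_def
    by (intro coeff_polys_add coeff_polys_const coeff_polys_const_mult coeff_polys_x) auto
  have k1: "k \<noteq> 1" using k by auto
  have sp: "coeff (specialize \<epsilon> (H i)) 0 = a i + b i * \<epsilon> k" for \<epsilon> i
    using k1 by (simp add: H_def specialize_add specialize_mult specialize_const specialize_x)
  have "b i * (\<gamma> k - \<delta> k) = coeff p i - coeff r i" for i
    using k by (simp add: b_def)
  then have "a i + b i * \<gamma> k = coeff p i" "a i + b i * \<delta> k = coeff r i" for i
    by (simp_all add: a_def algebra_simps)
  then have "specialize \<gamma> (\<Sum>i<l. H i * mp_x 1 ^ i) = p" "specialize \<delta> (\<Sum>i<l. H i * mp_x 1 ^ i) = r"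
    by (simp_all only: specialize_lower_terms[OF mem] sp sum_monom_coeff[OF deg(1)] sum_monom_coeff[OF deg(2)])
  with mem show ?thesis by blast
qed

definition form_fibre ::
    "nat \<Rightarrow> nat \<Rightarrow> (nat \<Rightarrow> 'a::field) \<Rightarrow> (nat \<Rightarrow> 'a) \<Rightarrow> 'a poly \<Rightarrow> 'a poly \<Rightarrow> 'a mp set" where
  "form_fibre n l \<gamma> \<delta> u v = {f \<in> form_polys n l. specialize \<gamma> f = u \<and> specialize \<delta> f = v}"

text \<open>
  An affine map \<open>f \<mapsto> a f + h\<close> with \<open>a \<noteq> 0\<close> and \<open>h\<close> of degree less than \<open>l\<close> in \<open>x\<^sub>1\<close>
  carries one fibre into the other.
\<close>

lemma card_form_fibre_le:
  fixes \<gamma> \<delta> :: "nat \<Rightarrow> 'a::{finite,field}"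
  assumes k: "k \<in> {2..n}" "\<gamma> k \<noteq> \<delta> k"
    and mon: "u \<in> monics l" "v \<in> monics l" "u' \<in> monics l" "v' \<in> monics l"
    and c: "c \<noteq> 0" "c' \<noteq> 0"
  shows "card (form_fibre n l \<gamma> \<delta> (smult c u) (smult c v))
    \<le> card (form_fibre n l \<gamma> \<delta> (smult c' u') (smult c' v'))"
proof -
  \<comment> \<open>The leading terms of two monic polynomials of degree \<open>l\<close> cancel, so
    their difference can be interpolated.\<close>
  have co: "coeff (smult c' (p' - p)) i = 0" if "p \<in> monics l" "p' \<in> monics l" "i \<ge> l" for p p' i
    using that by (cases "i = l") (auto simp: monics_def coeff_eq_0)
  obtain H where H: "\<And>i. i < l \<Longrightarrow> H i \<in> coeff_polys n (l - i)"
    and sp: "specialize \<gamma> (\<Sum>i<l. H i * mp_x 1 ^ i) = smult c' (u' - u)"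
      "specialize \<delta> (\<Sum>i<l. H i * mp_x 1 ^ i) = smult c' (v' - v)"
    using specialize_interpolate[of k n \<gamma> \<delta> l "smult c' (u' - u)" "smult c' (v' - v)"] k co mon by blast
  define h where "h = (\<Sum>i<l. H i * mp_x 1 ^ i)"
  note sp = sp[folded h_def]
  \<comment> \<open>Scaling by \<open>a\<close> turns the constant \<open>c\<close> into
    \<open>c'\<close> at both points; adding \<open>h\<close> then gives
    \<open>c' u + c' (u' - u) = c' u'\<close>, and likewise for \<open>v\<close>.\<close>
  define a where "a = c' / c"
  define F where "F f = mp_const a * f + h" for f
  have a0: "a \<noteq> 0" "a * c = c'" "c * a = c'" using c by (auto simp: a_def)
  have "inj_on F S" for S
  proof (rule inj_onI)
    fix f g assume "F f = F g"
    then have "mp_const (1 / a) * (mp_const a * f) = mp_const (1 / a) * (mp_const a * g)"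
      by (simp add: F_def)
    then show "f = g"
      using a0 by (simp add: mult.assoc[symmetric] mp_const_mult) (simp add: mp_const_def)
  qed
  moreover have "F f \<in> form_fibre n l \<gamma> \<delta> (smult c' u') (smult c' v')"
    if f: "f \<in> form_fibre n l \<gamma> \<delta> (smult c u) (smult c v)" for f
  proof -
    obtain b C where b: "f = form l b C" "b \<noteq> 0" "\<And>i. i < l \<Longrightarrow> C (l - i) \<in> coeff_polys n (l - i)"
      using f form_polysD[of f n l] unfolding form_fibre_def by blast
    \<comment> \<open>\<open>C'\<close> is indexed by the degree bound and \<open>H\<close> by the
      power of \<open>x_1\<close>, hence the argument \<open>l - j\<close>.\<close>
    define C' where "C' j = mp_const a * C j + H (l - j)" for j
    have "F f = form l (a * b) C'"
      by (simp add: F_def h_def b(1) form_def C'_def mp_const_mult[symmetric] algebra_simps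
            sum.distrib sum_distrib_left)
    moreover have "C' (l - i) \<in> coeff_polys n (l - i)" if "i < l" for i
      using that b(3) H by (auto simp: C'_def intro!: coeff_polys_add coeff_polys_const_mult)
    ultimately have "F f \<in> form_polys n l"
      using a0 b(2) by (simp add: form_polysI)
    moreover have "specialize \<gamma> (F f) = smult c' u'" "specialize \<delta> (F f) = smult c' v'"
      using f a0 by (simp_all add: F_def sp specialize_add specialize_mult specialize_const
        form_fibre_def smult_diff_right)
    ultimately show ?thesis by (simp add: form_fibre_def)
  qed
  ultimately show ?thesis
    by (intro card_inj_on_le[of F]) (auto simp: form_fibre_def finite_form_polys)
qed

text \<open>The inequality is used in both directions against the reference fibre where both
  specializations are the monomial of degree \<open>l\<close>.\<close>

lemma card_form_fibre_const:
  fixes \<gamma> \<delta> :: "nat \<Rightarrow> 'a::{finite,field}"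
  assumes "k \<in> {2..n}" "\<gamma> k \<noteq> \<delta> k"
  shows "\<exists>K. \<forall>c u v. c \<noteq> 0 \<longrightarrow> u \<in> monics l \<longrightarrow> v \<in> monics l \<longrightarrow>
    card (form_fibre n l \<gamma> \<delta> (smult c u) (smult c v)) = K"
proof -
  have "monom 1 l \<in> (monics l :: 'a poly set)" by (simp add: monics_def degree_monom_eq)
  then show ?thesis
    by (intro exI[of _ "card (form_fibre n l \<gamma> \<delta> (smult 1 (monom 1 l)) (smult 1 (monom 1 l)))"])
       (auto intro!: antisym card_form_fibre_le[where \<gamma> = \<gamma> and \<delta> = \<delta>, OF assms] simp del: smult_1_left)
qed

section \<open>Monic parts and their independence at two points\<close>

definition monic_part :: "'a::field poly \<Rightarrow> 'a poly" where
  "monic_part p = smult (inverse (lead_coeff p)) p"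

text \<open>Scaling by a nonzero constant preserves coprimality; since
  \<open>monic_part 0 = 0\<close>, the zero polynomial is no exception.\<close>

lemma coprime_monic_part_iff: "coprime (monic_part p) (monic_part q) \<longleftrightarrow> coprime p q"
proof -
  have "\<exists>a. a \<noteq> 0 \<and> monic_part r = smult a r" for r :: "'a poly"
  proof (cases "r = 0")
    case True
    then show ?thesis by (intro exI[of _ 1]) (simp add: monic_part_def)
  next
    case False
    then show ?thesis by (intro exI[of _ "inverse (lead_coeff r)"]) (simp add: monic_part_def)
  qed
  then show ?thesis by (metis coprime_smult_iff)
qed

lemma monic_part_smult:
  assumes "c \<noteq> 0" "u \<in> monics l"
  shows "lead_coeff (smult c u) = c" "monic_part (smult c u) = u"
  using assms by (auto simp: monic_part_def monics_def)

lemma smult_lead_coeff_monic_part: "smult (lead_coeff p) (monic_part p) = p"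
  by (cases "p = 0") (auto simp: monic_part_def)

text \<open>Rewrites fibres in coordinates that vary independently. The leading coefficient at
  \<open>\<delta>\<close> is fixed by the one at \<open>\<gamma>\<close>, so it is not a further
  coordinate.\<close>

lemma form_fibre_eq_monic_parts:
  assumes "c \<noteq> 0" "u \<in> monics l" "v \<in> monics l"
  shows "form_fibre n l \<gamma> \<delta> (smult c u) (smult c v) = {f \<in> form_polys n l.
    lead_coeff (specialize \<gamma> f) = c \<and> monic_part (specialize \<gamma> f) = u \<and> monic_part (specialize \<delta> f) = v}"
proof -
  have "lead_coeff (specialize \<gamma> f) = c \<and> monic_part (specialize \<gamma> f) = u \<and> monic_part (specialize \<delta> f) = v
      \<longleftrightarrow> specialize \<gamma> f = smult c u \<and> specialize \<delta> f = smult c v" if "f \<in> form_polys n l" for f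
    using specialize_form_polys[OF that] monic_part_smult assms smult_lead_coeff_monic_part by metis
  then show ?thesis by (auto simp: form_fibre_def)
qed

text \<open>
  The leading coefficients at \<open>\<gamma>\<close> and \<open>\<delta>\<close> coincide, so it is only the monic parts that are
  independent.
\<close>

lemma card_joint_monic_parts:
  fixes \<gamma> \<delta> :: "nat \<Rightarrow> 'a::{finite,field}"
  assumes k: "k \<in> {2..n}" "\<gamma> k \<noteq> \<delta> k"
  defines "M \<epsilon> \<equiv> \<lambda>(f, g). (monic_part (specialize \<epsilon> f), monic_part (specialize \<epsilon> g))"
  shows "\<exists>K. \<forall>R S. card {x \<in> form_polys n l \<times> form_polys n m. R (M \<gamma> x) \<and> S (M \<delta> x)}
    = K * card {w \<in> monics l \<times> monics m. R w} * card {w \<in> monics l \<times> monics m. S w}"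
proof -
  obtain K L where K: "\<And>c u v. c \<noteq> 0 \<Longrightarrow> u \<in> monics l \<Longrightarrow> v \<in> monics l \<Longrightarrow>
      card (form_fibre n l \<gamma> \<delta> (smult c u) (smult c v)) = K"
    and L: "\<And>c u v. c \<noteq> 0 \<Longrightarrow> u \<in> monics m \<Longrightarrow> v \<in> monics m \<Longrightarrow>
      card (form_fibre n m \<gamma> \<delta> (smult c u) (smult c v)) = L"
    using card_form_fibre_const[of k n \<gamma> \<delta> l, OF k] card_form_fibre_const[of k n \<gamma> \<delta> m, OF k] by metis
  define A where "A = (form_polys n l \<times> form_polys n m :: ('a mp \<times> 'a mp) set)"
  define U where "U = (UNIV - {0} :: 'a set)"
  define MM where "MM = (monics l \<times> monics m :: ('a poly \<times> 'a poly) set)"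
  define B where "B = (U \<times> U) \<times> MM \<times> MM"
  define \<Psi> where "\<Psi> x = ((lead_coeff (specialize \<gamma> (fst x)), lead_coeff (specialize \<gamma> (snd x))), M \<gamma> x, M \<delta> x)" for x
  have fin: "finite A" "finite B"
    by (simp_all add: A_def B_def MM_def U_def finite_form_polys finite_monics)
  have im: "lead_coeff (specialize \<epsilon> f) \<in> U" "monic_part (specialize \<epsilon> f) \<in> monics j"
    if "f \<in> form_polys n j" for f \<epsilon> j
    using specialize_form_polys[OF that] monic_part_smult unfolding U_def by (metis DiffI UNIV_I singletonD)+
  have "\<Psi> ` A \<subseteq> B"
    using im by (auto simp: A_def B_def MM_def \<Psi>_def M_def)
  moreover have "card {x \<in> A. \<Psi> x = b} = K * L" if "b \<in> B" for b
  proof -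
    obtain c d u u' v v' where b: "b = ((c, d), (u, u'), (v, v'))" by (metis prod.collapse)
    have mem: "c \<noteq> 0" "d \<noteq> 0" "u \<in> monics l" "v \<in> monics l" "u' \<in> monics m" "v' \<in> monics m"
      using that by (auto simp: b B_def U_def MM_def)
    \<comment> \<open>The conditions on \<open>f\<close> and on \<open>g\<close> are separate, so
      the fibre is a product.\<close>
    have "{x \<in> A. \<Psi> x = b} = form_fibre n l \<gamma> \<delta> (smult c u) (smult c v) \<times>
        form_fibre n m \<gamma> \<delta> (smult d u') (smult d v')"
      unfolding form_fibre_eq_monic_parts[OF mem(1,3,4)] form_fibre_eq_monic_parts[OF mem(2,5,6)]
      by (auto simp: A_def \<Psi>_def M_def b)
    then show ?thesis using mem by (simp add: card_cartesian_product K L)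
  qed
  ultimately have *: "card {x \<in> A. Q (\<Psi> x)} = K * L * card {b \<in> B. Q b}" for Q
    using fin by (intro card_filter_uniform_fibres)
  have "card {x \<in> A. R (M \<gamma> x) \<and> S (M \<delta> x)} =
      K * L * card (U \<times> U) * card {w \<in> MM. R w} * card {w \<in> MM. S w}" for R S
  proof -
    \<comment> \<open>\<open>R\<close> and \<open>S\<close> ignore the leading coefficients, whose
      \<open>card (U \<times> U)\<close> choices enter the constant.\<close>
    have "{b \<in> B. R (fst (snd b)) \<and> S (snd (snd b))} = (U \<times> U) \<times> {w \<in> MM. R w} \<times> {w \<in> MM. S w}"
      by (auto simp: B_def)
    then show ?thesis
      using *[of "\<lambda>b. R (fst (snd b)) \<and> S (snd (snd b))"] by (simp add: \<Psi>_def card_cartesian_product)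
  qed
  then show ?thesis unfolding A_def MM_def by blast
qed

text \<open>The constant \<open>K\<close> is never computed: trivial predicates give
  \<open>card A = K * Q * Q\<close>, and \<open>Q = CARD('a) * N\<close> turns
  \<open>K * N * Q\<close> and \<open>K * N * N\<close> into the stated fractions of it.\<close>

lemma card_noncoprime_specializations:
  fixes \<gamma> \<delta> :: "nat \<Rightarrow> 'a::{finite,field}"
  assumes lm: "l > 0" "m > 0" and k: "k \<in> {2..n}" "\<gamma> k \<noteq> \<delta> k"
  defines "A \<equiv> form_polys n l \<times> form_polys n m"
    and "NC \<epsilon> x \<equiv> \<not> coprime (specialize \<epsilon> (fst x)) (specialize \<epsilon> (snd x))"
  shows "real (card {x \<in> A. NC \<gamma> x}) = 1 / real CARD('a) * card A"
    and "real (card {x \<in> A. NC \<gamma> x \<and> NC \<delta> x}) = (1 / real CARD('a))\<^sup>2 * card A"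
proof -
  define M where "M \<epsilon> = (\<lambda>(f, g). (monic_part (specialize \<epsilon> f), monic_part (specialize \<epsilon> g)))"
    for \<epsilon> :: "nat \<Rightarrow> 'a"
  define R :: "'a poly \<times> 'a poly \<Rightarrow> bool" where "R w \<longleftrightarrow> \<not> coprime (fst w) (snd w)" for w
  obtain K where K: "\<And>R S. card {x \<in> A. R (M \<gamma> x) \<and> S (M \<delta> x)}
    = K * card {w \<in> monics l \<times> monics m. R w} * card {w \<in> monics l \<times> monics m. S w}"
    using card_joint_monic_parts[of k n \<gamma> \<delta> l m, OF k] unfolding A_def M_def by blast
  have NC: "NC \<epsilon> x \<longleftrightarrow> R (M \<epsilon> x)" for \<epsilon> x
    by (simp add: NC_def R_def M_def coprime_monic_part_iff split: prod.split)
  define N where "N = card {w \<in> monics l \<times> monics m. R w}"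
  define Q where "Q = card (monics l \<times> monics m :: ('a poly \<times> 'a poly) set)"
  have "CARD('a) * N = Q"
    using card_noncoprime_monics[where 'a = 'a, OF lm]
    by (simp add: N_def Q_def noncoprime_monics_def R_def card_cartesian_product card_monics power_add)
  then have Q: "real Q = real CARD('a) * real N" by (metis of_nat_mult)
  have A: "card A = K * Q * Q"
    using K[of "\<lambda>_. True" "\<lambda>_. True"] by (simp add: Q_def)
  have "card {x \<in> A. NC \<gamma> x} = K * N * Q"
    using K[of R "\<lambda>_. True"] by (simp add: Q_def N_def NC)
  then show "real (card {x \<in> A. NC \<gamma> x}) = 1 / real CARD('a) * card A"
    by (simp add: A Q)
  have "card {x \<in> A. NC \<gamma> x \<and> NC \<delta> x} = K * N * N"
    using K[of R R] by (simp add: N_def NC)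
  then show "real (card {x \<in> A. NC \<gamma> x \<and> NC \<delta> x}) = (1 / real CARD('a))\<^sup>2 * card A"
    by (simp add: A Q power2_eq_square)
qed

section \<open>Expectation and variance of the count\<close>

theorem theorem3:
  fixes n l m :: nat and P :: "('a::{finite,field} mp \<times> 'a mp) pmf"
    and X :: "'a mp \<times> 'a mp \<Rightarrow> real"
  assumes "n > 1" and "l > 0" and "m > 0"
    and "P = random_pair n l m"
    and "\<And>f g. X (f, g) = real (noncoprime_count n f g)"
  shows "measure_pmf.expectation P X = real CARD('a) ^ (n - 2) \<and>
         measure_pmf.variance P X = real CARD('a) ^ (n - 2) * (1 - 1 / real CARD('a))"
proof -
  define A where "A = (form_polys n l \<times> form_polys n m :: ('a mp \<times> 'a mp) set)"
  define G where "G = ({2..n} \<rightarrow>\<^sub>E (UNIV :: 'a set))"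
  define NC where "NC \<gamma> x \<longleftrightarrow> \<not> coprime (specialize \<gamma> (fst x)) (specialize \<gamma> (snd x))"
    for \<gamma> and x :: "'a mp \<times> 'a mp"
  have A: "finite A" "A \<noteq> {}"
    by (simp_all add: A_def finite_form_polys form_polys_nonempty)
  have G: "finite G" by (simp add: G_def finite_PiE)
  \<comment> \<open>The one-point count comes from the two-point lemma with an auxiliary point that
    differs in coordinate 2, which exists since \<open>n > 1\<close>.\<close>
  have single: "real (card {x \<in> A. NC \<gamma> x}) = 1 / real CARD('a) * card A" for \<gamma>
    unfolding A_def NC_def using assms
    by (intro card_noncoprime_specializations(1)[where k = 2 and \<delta> = "\<gamma>(2 := \<gamma> 2 + 1)"]) auto
  have joint: "real (card {x \<in> A. NC \<gamma> x \<and> NC \<delta> x}) = (1 / real CARD('a))\<^sup>2 * card A"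
    if "\<gamma> \<in> G" "\<delta> \<in> G" "\<gamma> \<noteq> \<delta>" for \<gamma> \<delta>
  proof -
    \<comment> \<open>Extensional functions agreeing on \<open>{2..n}\<close> are equal, so distinct
      points differ in some coordinate \<open>k\<close>, where interpolation applies.\<close>
    have "\<not> (\<forall>k\<in>{2..n}. \<gamma> k = \<delta> k)"
      using PiE_ext[OF that(1,2)[unfolded G_def]] that(3) by auto
    then obtain k where "k \<in> {2..n}" "\<gamma> k \<noteq> \<delta> k" by blast
    then show ?thesis
      unfolding A_def NC_def using assms by (intro card_noncoprime_specializations(2)[where k = k])
  qed
  have X: "X x = real (card {\<gamma> \<in> G. NC \<gamma> x})" for x
    by (cases x) (simp add: assms(5) noncoprime_count_def G_def NC_def)
  have P: "P = pmf_of_set A" by (simp add: assms(4) random_pair_def A_def)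
  have "card G = CARD('a) ^ (n - 1)" by (simp add: G_def card_PiE)
  moreover have "n - 1 = Suc (n - 2)" using assms by simp
  ultimately have q: "real (card G) * (1 / real CARD('a)) = real CARD('a) ^ (n - 2)" by simp
  have "measure_pmf.expectation P X = card G * (1 / real CARD('a))"
    unfolding P by (rule pairwise_independent_count(1)[OF A G single joint X])
  moreover have "measure_pmf.variance P X = card G * (1 / real CARD('a)) * (1 - 1 / real CARD('a))"
    unfolding P by (rule pairwise_independent_count(2)[OF A G single joint X])
  ultimately show ?thesis unfolding q by blast
qed

end
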